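(* Let $E=10$ and $O=01$ be binary words, and for given initial binary words $S_0,I_0$ define recursively, for $k\ge 0$, $$I_{k+1}=O\,S_kI_kS_kI_kS_k\,E,\qquad S_{k+1}=(S_kI_kS_kI_kS_k)\,E\,(S_kI_kS_k)\,O\,(S_kI_kS_kI_kS_k).$$ (a) (Articulated worms.) Let $S_0$ be the empty word and $I_0=0$. Let $a=\frac{2}{19}(5-\sqrt6)$. Then $a=[0;3,\overline{1,2,1,1}]$, and the standard sequence $(s_n)_{n\ge0}$ with slope $a$ satisfies, for all $k\ge0$, $$s_{4k+3}=S_kI_kS_kI_kS_kE,\quad s_{4k+4}=S_{k+1}O,\quad s_{4k+5}=S_{k+1}I_{k+1},\quad s_{4k+6}=S_{k+1}I_{k+1}S_{k+1}O.$$ (b) (Wriggly worms.) Let instead $S_0=00$ and $I_0=010$. Let $b=\frac1{19}(9-2\sqrt6)$. Then $b=[0;4,\overline{1,1,1,2}]$, and the standard sequence $(s_n)_{n\ge0}$ with slope $b$ satisfies, for all $k\ge0$, $$s_{4k+3}=S_kI_k,\quad s_{4k+4}=S_kI_kS_kO,\quad s_{4k+5}=S_kI_kS_kI_kS_kE,\quad s_{4k+6}=S_{k+1}O.$$ (c) The number $a$ is a root of $19x^2-20x+4=0$ and $b$ is a root of $19x^2-18x+3=0$, and $19(1-x)^2-20(1-x)+4=19x^2-18x+3$. The binary complement of the characteristic word for $a$ is the characteristic word for the other root $\frac1{19}(9+2\sqrt6)$ of $19x^2-18x+3=0$ (the conjugate of $b$), and the binary complement of the characteristic word for $b$ is the characteristic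 word for the other root $\frac{2}{19}(5+\sqrt6)$ of $19x^2-20x+4=0$ (the conjugate of $a$).
   Context: Juxtaposition of words is concatenation, and $w^d$ is the $d$-fold concatenation of $w$ (empty if $d=0$). For an irrational number $a\in(0,1)$ write its continued fraction as $a=[0;1+d_1,d_2,d_3,\dots]$ with $d_1\ge0$ and $d_i\ge1$ for $i\ge2$. The standard sequence with slope $a$ is the sequence of binary words defined by $s_0=1$, $s_1=0$, and $s_{k+1}=s_k^{d_k}s_{k-1}$ for $k\ge1$. It converges to an infinite binary word called the characteristic word for $a$ (the infinite word having $s_n$ as a prefix for all sufficiently large $n$). The overline in $[0;c,\overline{p_1,\dots,p_m}]$ denotes periodic repetition. The binary complement of a word is obtained by exchanging the letters $0$ and $1$. (The words $S_k,I_k$ encode strips of tiles, "Conway worms", in tilings by the Spectre tile, with $0$ for an even tile and $1$ for an odd tile.) *)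

theory Defs
  imports Complex_Main "HOL-Library.Z2"
begin

section \<open>Continued fractions\<close>

text \<open>Complete quotients and partial quotients (coefficients) of the continued fraction
  of a real number, indexed from 0.  They are meaningful at every index when the number
  is irrational.\<close>

primrec cf_quotient :: "real \<Rightarrow> nat \<Rightarrow> real" where
  "cf_quotient x 0 = x"
| "cf_quotient x (Suc n) = 1 / frac (cf_quotient x n)"

definition cf_coeff :: "real \<Rightarrow> nat \<Rightarrow> int" where
  "cf_coeff x n = \<lfloor>cf_quotient x n\<rfloor>"

text \<open>\<open>cf_convergent c n\<close> is the finite continued fraction $[c_0; c_1, \dots, c_n]$.\<close>

primrec cf_convergent :: "(nat \<Rightarrow> int) \<Rightarrow> nat \<Rightarrow> real" where
  "cf_convergent c 0 = of_int (c 0)"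
| "cf_convergent c (Suc n) = of_int (c 0) + 1 / cf_convergent (\<lambda>i. c (Suc i)) n"

text \<open>\<open>x\<close> is the value of the infinite continued fraction $[c_0; c_1, c_2, \dots]$, and the
  \<open>c\<^sub>i\<close> are the coefficients of its continued fraction.\<close>

definition has_cf :: "real \<Rightarrow> (nat \<Rightarrow> int) \<Rightarrow> bool" where
  "has_cf x c \<longleftrightarrow> cf_convergent c \<longlonglongrightarrow> x \<and> cf_coeff x = c"

text \<open>The list \<open>pre\<close> followed by periodic repetition of the non-empty list \<open>per\<close>.\<close>

definition ev_periodic :: "'a list \<Rightarrow> 'a list \<Rightarrow> nat \<Rightarrow> 'a" where
  "ev_periodic pre per n =
     (if n < length pre then pre ! n else per ! ((n - length pre) mod length per))"

section \<open>Binary words, standard sequences and characteristic words\<close>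

type_synonym bword = "bit list"

definition wpow :: "'a list \<Rightarrow> nat \<Rightarrow> 'a list" where
  "wpow w d = concat (replicate d w)"

text \<open>The slope is written as $[0; 1 + d_1, d_2, d_3, \dots]$; only indices \<open>k \<ge> 1\<close> matter.
  For an irrational slope in $(0,1)$ the truncation to \<^typ>\<open>nat\<close> never bites.\<close>

definition slope_exponent :: "real \<Rightarrow> nat \<Rightarrow> nat" where
  "slope_exponent x k = nat (if k = 1 then cf_coeff x 1 - 1 else cf_coeff x k)"

fun standard_seq :: "real \<Rightarrow> nat \<Rightarrow> bword" where
  "standard_seq x 0 = [1]"
| "standard_seq x (Suc 0) = [0]"
| "standard_seq x (Suc (Suc k)) =
     wpow (standard_seq x (Suc k)) (slope_exponent x (Suc k)) @ standard_seq x k"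

definition is_prefix_of :: "'a list \<Rightarrow> (nat \<Rightarrow> 'a) \<Rightarrow> bool" where
  "is_prefix_of u w \<longleftrightarrow> (\<forall>i<length u. u ! i = w i)"

definition is_characteristic_word :: "real \<Rightarrow> (nat \<Rightarrow> bit) \<Rightarrow> bool" where
  "is_characteristic_word x w \<longleftrightarrow> (\<exists>N. \<forall>n\<ge>N. is_prefix_of (standard_seq x n) w)"

definition characteristic_word :: "real \<Rightarrow> nat \<Rightarrow> bit" where
  "characteristic_word x = (THE w. is_characteristic_word x w)"

definition bit_complement :: "bit \<Rightarrow> bit" where
  "bit_complement c = (if c = 0 then 1 else 0)"

definition word_complement :: "(nat \<Rightarrow> bit) \<Rightarrow> nat \<Rightarrow> bit" where
  "word_complement w = (\<lambda>n. bit_complement (w n))"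

section \<open>The worms\<close>

definition wE :: bword where "wE = [1, 0]"
definition wO :: bword where "wO = [0, 1]"

text \<open>The first two arguments are the initial words \<open>S\<^sub>0\<close> and \<open>I\<^sub>0\<close>.\<close>

fun worm_S :: "bword \<Rightarrow> bword \<Rightarrow> nat \<Rightarrow> bword"
  and worm_I :: "bword \<Rightarrow> bword \<Rightarrow> nat \<Rightarrow> bword" where
  "worm_S S0 I0 0 = S0"
| "worm_I S0 I0 0 = I0"
| "worm_S S0 I0 (Suc k) =
    (let S = worm_S S0 I0 k; I = worm_I S0 I0 k
     in (S @ I @ S @ I @ S) @ wE @ (S @ I @ S) @ wO @ (S @ I @ S @ I @ S))"
| "worm_I S0 I0 (Suc k) =
    (let S = worm_S S0 I0 k; I = worm_I S0 I0 k
     in wO @ S @ I @ S @ I @ S @ wE)"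

section \<open>Well-definedness of the characteristic word\<close>

lemma cf_quotient_irrational:
  assumes "x \<notin> \<rat>"
  shows "cf_quotient x n \<notin> \<rat>"
proof (induction n)
  case 0
  then show ?case using assms by simp
next
  case (Suc n)
  show ?case
  proof
    assume "cf_quotient x (Suc n) \<in> \<rat>"
    then have "inverse (1 / frac (cf_quotient x n)) \<in> \<rat>"
      unfolding cf_quotient.simps by (rule Rats_inverse)
    then have "frac (cf_quotient x n) \<in> \<rat>" by (simp only: inverse_divide div_by_1)
    then have "frac (cf_quotient x n) + of_int \<lfloor>cf_quotient x n\<rfloor> \<in> \<rat>"
      by (intro Rats_add Rats_of_int)
    then show False using Suc by (simp add: frac_def)
  qed
qed

lemma cf_coeff_pos:
  assumes "x \<notin> \<rat>"
  shows "cf_coeff x (Suc n) \<ge> 1"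
proof -
  have "cf_quotient x n \<notin> \<int>"
    using cf_quotient_irrational[OF assms, of n] Ints_subset_Rats by blast
  then have "0 < frac (cf_quotient x n)" by simp
  moreover have "frac (cf_quotient x n) < 1" by (rule frac_lt_1)
  ultimately have "1 \<le> cf_quotient x (Suc n)" by simp
  then show ?thesis by (simp add: cf_coeff_def)
qed

lemma standard_seq_step:
  assumes "x \<notin> \<rat>"
  shows "\<exists>v. standard_seq x (Suc (Suc (Suc k))) = standard_seq x (Suc (Suc k)) @ v @ standard_seq x (Suc k)"
proof -
  have "slope_exponent x (Suc (Suc k)) \<noteq> 0"
    using cf_coeff_pos[OF assms, of "Suc k"] by (simp add: slope_exponent_def)
  then obtain d where "slope_exponent x (Suc (Suc k)) = Suc d"
    using not0_implies_Suc by blast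
  then show ?thesis by (auto simp: wpow_def simp del: standard_seq.simps(3)
      simp add: standard_seq.simps(3)[of x "Suc k"])
qed

lemma standard_seq_nonempty: "standard_seq x k \<noteq> []"
  by (induction x k rule: standard_seq.induct) auto

lemma standard_seq_length:
  assumes "x \<notin> \<rat>"
  shows "length (standard_seq x (Suc (Suc k))) > k"
proof (induction k)
  case 0
  then show ?case using standard_seq_nonempty[of x "Suc (Suc 0)"] by blast
next
  case (Suc k)
  obtain v where v: "standard_seq x (Suc (Suc (Suc k))) =
      standard_seq x (Suc (Suc k)) @ v @ standard_seq x (Suc k)"
    using standard_seq_step[OF assms] by blast
  have "length (standard_seq x (Suc k)) > 0" using standard_seq_nonempty by blast
  then show ?case using Suc unfolding v length_append by linarith
qed

lemma standard_seq_mono: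
  assumes "x \<notin> \<rat>" "m \<le> n"
  shows "\<exists>v. standard_seq x (Suc (Suc n)) = standard_seq x (Suc (Suc m)) @ v"
  using assms(2)
proof (induction n rule: dec_induct)
  case base
  show ?case by simp
next
  case (step n)
  obtain u where "standard_seq x (Suc (Suc n)) = standard_seq x (Suc (Suc m)) @ u"
    using step.IH by blast
  moreover obtain v where "standard_seq x (Suc (Suc (Suc n))) =
      standard_seq x (Suc (Suc n)) @ v @ standard_seq x (Suc n)"
    using standard_seq_step[OF assms(1)] by blast
  ultimately have "standard_seq x (Suc (Suc (Suc n))) =
      standard_seq x (Suc (Suc m)) @ (u @ v @ standard_seq x (Suc n))"
    by (simp del: standard_seq.simps)
  then show ?case by blast
qed

theorem characteristic_word_exists_unique:
  assumes "x \<notin> \<rat>"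
  shows "\<exists>!w. is_characteristic_word x w"
proof
  let ?w = "\<lambda>i. standard_seq x (Suc (Suc i)) ! i"
  have "is_prefix_of (standard_seq x n) ?w" if n: "n \<ge> 2" for n
    unfolding is_prefix_of_def
  proof (intro allI impI)
    fix i assume i: "i < length (standard_seq x n)"
    obtain m where m: "n = Suc (Suc m)"
      using n by (metis Suc_le_D numeral_2_eq_2 Suc_le_mono)
    show "standard_seq x n ! i = standard_seq x (Suc (Suc i)) ! i"
    proof (cases "m \<le> i")
      case True
      then show ?thesis using standard_seq_mono[OF assms True] i m
        by (auto simp: nth_append simp del: standard_seq.simps)
    next
      case False
      then have "i \<le> m" by simp
      then show ?thesis using standard_seq_mono[OF assms, of i m] standard_seq_length[OF assms, of i] m
        by (auto simp: nth_append simp del: standard_seq.simps)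
    qed
  qed
  then show ex: "is_characteristic_word x ?w"
    unfolding is_characteristic_word_def by blast
  fix w assume "is_characteristic_word x w"
  then obtain N where N: "\<forall>n\<ge>N. is_prefix_of (standard_seq x n) w"
    unfolding is_characteristic_word_def by blast
  show "w = ?w"
  proof
    fix i
    let ?n = "Suc (Suc (max N i))"
    have "i < length (standard_seq x ?n)"
      using standard_seq_length[OF assms, of "max N i"] by linarith
    moreover have "is_prefix_of (standard_seq x ?n) w" using N by (simp del: standard_seq.simps)
    ultimately have "w i = standard_seq x ?n ! i" unfolding is_prefix_of_def by simp
    also have "\<dots> = ?w i"
      using standard_seq_mono[OF assms, of i "max N i"] standard_seq_length[OF assms, of i]
      by (auto simp: nth_append simp del: standard_seq.simps)
    finally show "w i = ?w i" .
  qed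
qed

corollary characteristic_word_works:
  assumes "x \<notin> \<rat>"
  shows "is_characteristic_word x (characteristic_word x)"
  unfolding characteristic_word_def
  using theI'[OF characteristic_word_exists_unique[OF assms]] .

end

(* In both families the exchange relation O S_k I_k = I_k S_k E holds, and it propagates from k to
   k+1.  It is the only relation between the words that is needed: reading it as the rewrite rule
   OSI -> ISE, the standard recursion over one period of the continued fraction reduces to the
   recursion for S_k, I_k.
   For x = [0;1+d_1,d_2,...] < 1/2 one has 1 - x = [0;1,d_1,d_2,...], so the standard sequence of
   1 - x is the complemented standard sequence of x, delayed by one; and b' = 1 - a, a' = 1 - b. *)
theory Submission
  imports Defs
begin

section \<open>Regular continued fractions of irrational numbers: convergence and detection of
  periodicity\<close>

section \<open>Continued fractions\<close>

text \<open>Complete quotients form the orbit of one map, so the tail of an expansion is the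
  expansion of a complete quotient.\<close>

lemma cf_quotient_add: "cf_quotient x (m + n) = cf_quotient (cf_quotient x m) n"
  by (induction n) auto

lemma cf_coeff_add: "cf_coeff x (m + n) = cf_coeff (cf_quotient x m) n"
  by (simp add: cf_coeff_def cf_quotient_add)

lemma cf_quotient_Suc_gt_1:
  assumes "x \<notin> \<rat>"
  shows "cf_quotient x (Suc n) > 1"
proof -
  have "cf_quotient x n \<notin> \<int>"
    using cf_quotient_irrational[OF assms, of n] Ints_subset_Rats by blast
  then have "0 < frac (cf_quotient x n)" by simp
  then show ?thesis using frac_lt_1[of "cf_quotient x n"] by simp
qed

lemma cf_quotient_unfold: "x = of_int (cf_coeff x 0) + 1 / cf_quotient x 1"
  by (simp add: cf_coeff_def frac_def)

lemma cf_convergent_ge_1: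
  assumes "\<And>i. c i \<ge> 1"
  shows "cf_convergent c n \<ge> 1"
  using assms
proof (induction n arbitrary: c)
  case (Suc n)
  have "cf_convergent (\<lambda>i. c (Suc i)) n \<ge> 1" by (rule Suc.IH) (rule Suc.prems)
  then show ?case using Suc.prems[of 0] by (simp add: add_increasing2)
qed simp

lemma cf_convergent_cf_coeff_Suc:
  "cf_convergent (cf_coeff x) (Suc n)
    = of_int (cf_coeff x 0) + 1 / cf_convergent (cf_coeff (cf_quotient x 1)) n"
proof -
  have "(\<lambda>i. cf_coeff x (Suc i)) = cf_coeff (cf_quotient x 1)"
    using cf_coeff_add[of x 1] by (simp only: fun_eq_iff plus_1_eq_Suc simp_thms)
  then show ?thesis by (simp only: cf_convergent.simps)
qed

text \<open>\<open>x\<close> and its convergent share the integer part, so their difference is that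
  of the reciprocals of \<open>y\<close> and of a convergent to \<open>y\<close>. The error of that
  convergent thus gets divided by the product of two numbers that are at least 1.\<close>

lemma cf_convergent_error_Suc:
  assumes "x \<notin> \<rat>"
  defines "y \<equiv> cf_quotient x 1"
  shows "\<bar>cf_convergent (cf_coeff x) (Suc n) - x\<bar>
      = \<bar>cf_convergent (cf_coeff y) n - y\<bar> / (y * cf_convergent (cf_coeff y) n)"
    and "y > 1" "cf_convergent (cf_coeff y) n \<ge> 1"
proof -
  show y: "y > 1" using cf_quotient_Suc_gt_1[OF assms(1), of 0] by (simp add: y_def)
  have "cf_coeff y i \<ge> 1" for i
    using cf_coeff_pos[OF assms(1), of i] cf_coeff_add[of x 1 i] by (simp add: y_def)
  then show f: "cf_convergent (cf_coeff y) n \<ge> 1" by (rule cf_convergent_ge_1)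
  let ?f = "cf_convergent (cf_coeff y) n"
  have "cf_convergent (cf_coeff x) (Suc n) - x = 1 / ?f - 1 / y"
    unfolding cf_convergent_cf_coeff_Suc using cf_quotient_unfold[of x] by (simp add: y_def)
  also have "\<dots> = (y - ?f) / (y * ?f)" using y f by (simp add: field_simps)
  finally show "\<bar>cf_convergent (cf_coeff x) (Suc n) - x\<bar> = \<bar>?f - y\<bar> / (y * ?f)"
    using y f by (simp add: abs_mult abs_minus_commute)
qed

(* A single step need not contract by a fixed factor, but two steps do: if y, z are consecutive
   complete quotients then y z = c z + 1 >= 2. *)
lemma cf_convergent_error:
  assumes "x \<notin> \<rat>"
  shows "\<bar>cf_convergent (cf_coeff x) n - x\<bar> \<le> (1 / 2) ^ (n div 2)"
  using assms
proof (induction n arbitrary: x rule: induct_nat_012)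
  case 0
  then show ?case by (simp add: cf_coeff_def) linarith
next
  case 1
  let ?y = "cf_quotient x 1"
  have "\<bar>cf_convergent (cf_coeff ?y) 0 - ?y\<bar> \<le> 1" by (simp add: cf_coeff_def) linarith
  moreover have "1 \<le> ?y * cf_convergent (cf_coeff ?y) 0"
    using cf_convergent_error_Suc(2)[OF 1] cf_convergent_error_Suc(3)[OF 1, of 0]
      mult_mono[of 1 ?y 1 "cf_convergent (cf_coeff ?y) 0"]
    by simp
  ultimately have "\<bar>cf_convergent (cf_coeff ?y) 0 - ?y\<bar> / (?y * cf_convergent (cf_coeff ?y) 0) \<le> 1 / 1"
    by (intro frac_le) auto
  then show ?case unfolding cf_convergent_error_Suc(1)[OF 1, of 0] by simp
next
  case (ge2 n)
  let ?y = "cf_quotient x 1"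
  let ?z = "cf_quotient ?y 1"
  let ?f = "cf_convergent (cf_coeff ?y) (Suc n)"
  let ?g = "cf_convergent (cf_coeff ?z) n"
  have y: "?y \<notin> \<rat>" and z: "?z \<notin> \<rat>"
    using cf_quotient_irrational ge2.prems by blast+
  have 1: "\<bar>cf_convergent (cf_coeff x) (Suc (Suc n)) - x\<bar> = \<bar>?f - ?y\<bar> / (?y * ?f)"
    "?y > 1" "?f \<ge> 1"
    using cf_convergent_error_Suc(1,3)[OF ge2.prems, of "Suc n"] cf_convergent_error_Suc(2)[OF ge2.prems]
    by blast+
  have 2: "\<bar>?f - ?y\<bar> = \<bar>?g - ?z\<bar> / (?z * ?g)" "?z > 1" "?g \<ge> 1"
    using cf_convergent_error_Suc(1,3)[OF y, of n] cf_convergent_error_Suc(2)[OF y] by blast+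
  \<comment> \<open>The integer part of \<open>?y\<close> is the partial quotient of
    \<open>x\<close> at index 1; unlike the one at index 0, it is always positive.\<close>
  have "real_of_int (cf_coeff ?y 0) \<ge> 1"
    using cf_coeff_pos[OF ge2.prems, of 0] cf_coeff_add[of x 1 0] by simp
  then have "1 * ?z + 1 \<le> of_int (cf_coeff ?y 0) * ?z + 1"
    using 2(2) by (intro add_right_mono mult_right_mono) simp_all
  also have "\<dots> = ?y * ?z"
  proof -
    have "c * z + 1 = y * z" if "y = c + 1 / z" "z > 1" for c y z :: real
      using that by (simp add: field_simps)
    from this[OF cf_quotient_unfold 2(2)] show ?thesis .
  qed
  finally have yz: "2 \<le> ?y * ?z" using 2(2) by linarith
  have fg: "1 \<le> ?f * ?g" using mult_mono[of 1 ?f 1 ?g] 1(3) 2(3) by simp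
  have yzfg: "2 \<le> (?y * ?z) * (?f * ?g)" using mult_mono[of 2 "?y * ?z" 1 "?f * ?g"] yz fg by simp
  have "\<bar>cf_convergent (cf_coeff x) (Suc (Suc n)) - x\<bar> = \<bar>?g - ?z\<bar> / ((?y * ?z) * (?f * ?g))"
    unfolding 1(1) 2(1) by (simp add: mult_ac)
  also have "\<dots> \<le> \<bar>?g - ?z\<bar> / 2"
    by (rule frac_le) (simp_all only: yzfg abs_ge_zero order_refl zero_less_numeral)
  also have "\<dots> \<le> (1 / 2) ^ (n div 2) / 2"
    using ge2.IH(1)[OF z] by simp
  finally show ?case by simp
qed

text \<open>Only convergence has content here, and the geometric error bound gives it. Proving
  \<open>has_cf\<close> for a given irrational number thereby reduces to computing its
  coefficients.\<close>

theorem has_cf_cf_coeff: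
  assumes "x \<notin> \<rat>"
  shows "has_cf x (cf_coeff x)"
proof -
  have "filterlim (\<lambda>n::nat. n div 2) sequentially sequentially"
    unfolding filterlim_at_top eventually_sequentially
    by (metis div_le_mono nonzero_mult_div_cancel_left zero_neq_numeral)
  then have "(\<lambda>n. (1 / 2 :: real) ^ (n div 2)) \<longlonglongrightarrow> 0"
    by (rule filterlim_compose[rotated]) (rule LIMSEQ_power_zero, simp)
  then have "(\<lambda>n. cf_convergent (cf_coeff x) n - x) \<longlonglongrightarrow> 0"
    by (rule tendsto_0_le[where K = 1]) (auto simp: cf_convergent_error[OF assms])
  then show ?thesis by (simp add: has_cf_def LIM_zero_iff)
qed

text \<open>Certifies one step of the expansion: a guessed next quotient \<open>r\<close> is
  confirmed by a product equal to 1, without rationalising a denominator.\<close>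

lemma cf_step:
  assumes "of_int c < q" "q < of_int c + 1" "(q - of_int c) * r = 1"
  shows "\<lfloor>q\<rfloor> = c \<and> 1 / frac q = r"
proof -
  have fl: "\<lfloor>q\<rfloor> = c" using assms by (intro floor_unique) auto
  show ?thesis using assms by (simp add: frac_def fl field_simps)
qed

text \<open>Each quotient determines the next one, so a single recurrence forces periodicity and
  finitely many coefficients remain to be checked.\<close>

lemma cf_coeff_eq_ev_periodic:
  assumes "per \<noteq> []"
    and per: "cf_quotient x (length pre + length per) = cf_quotient x (length pre)"
    and coeff: "\<And>n. n < length pre + length per \<Longrightarrow> cf_coeff x n = (pre @ per) ! n"
  shows "cf_coeff x = ev_periodic pre per"
proof
  fix n
  show "cf_coeff x n = ev_periodic pre per n"
  proof (induction n rule: less_induct)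
    case (less n)
    show ?case
    proof (cases "n < length pre + length per")
      case True
      then show ?thesis using coeff by (simp add: ev_periodic_def nth_append)
    next
      case False
      \<comment> \<open>\<open>length pre + m\<close> is \<open>n\<close> moved back by one period,
        where the induction hypothesis applies.\<close>
      define m where "m = n - length pre - length per"
      have n: "n = (length pre + length per) + m" using False by (simp add: m_def)
      have "cf_coeff x n = cf_coeff x (length pre + m)"
        unfolding n by (simp only: cf_coeff_add per)
      also have "\<dots> = ev_periodic pre per (length pre + m)"
        using less \<open>per \<noteq> []\<close> n by simp
      also have "\<dots> = ev_periodic pre per n"
        by (simp add: ev_periodic_def n)
      finally show ?thesis .
    qed
  qed
qed

section \<open>The reflection x to 1 - x and its effect on exponents, standard words and
  characteristic words\<close>

section \<open>Complements of characteristic words\<close>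

text \<open>For x < 1/2 the integer part of 1/(1-x) is 1, and inverting the remainder x/(1-x) gives
  1/x - 1. This differs from 1/x by an integer, so all later quotients agree up to a shift by
  one.\<close>

lemma cf_quotient_one_minus:
  assumes "0 < x" "x < 1 / 2"
  shows "cf_quotient (1 - x) 1 = 1 / (1 - x)"
    and "cf_quotient (1 - x) 2 = cf_quotient x 1 - 1"
    and "cf_quotient (1 - x) (n + 3) = cf_quotient x (n + 2)"
proof -
  have x: "frac x = x" "frac (1 - x) = 1 - x" using assms by (simp_all add: frac_eq)
  show 1: "cf_quotient (1 - x) 1 = 1 / (1 - x)" by (simp add: x)
  have "frac (1 / (1 - x)) = 1 / (1 - x) - 1"
    using assms by (subst frac_unique_iff) (auto simp: field_simps)
  then have "cf_quotient (1 - x) (Suc 1) = 1 / (1 / (1 - x) - 1)"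
    unfolding cf_quotient.simps(2) 1 by simp
  also have "\<dots> = 1 / x - 1" using assms by (simp add: field_simps)
  finally show 2: "cf_quotient (1 - x) 2 = cf_quotient x 1 - 1"
    by (simp add: x numeral_2_eq_2)
  have "frac (cf_quotient x 1 - 1) = frac (cf_quotient x 1)" by (simp add: frac_def)
  then have 3: "cf_quotient (1 - x) 3 = cf_quotient x 2"
    using 2 by (simp add: numeral_2_eq_2 numeral_3_eq_3)
  show "cf_quotient (1 - x) (n + 3) = cf_quotient x (n + 2)"
    using 3 cf_quotient_add[of "1 - x" 3 n] cf_quotient_add[of x 2 n] by (simp only: add.commute)
qed

text \<open>The 1 that \<open>slope_exponent\<close> subtracts at index 1 is exactly the 1 lost in
  1/x - 1. Hence the exponents of 1 - x are those of x with a 0 put in front.\<close>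

lemma slope_exponent_one_minus:
  assumes "0 < x" "x < 1 / 2"
  shows "slope_exponent (1 - x) (Suc 0) = 0"
    and "slope_exponent (1 - x) (Suc (Suc k)) = slope_exponent x (Suc k)"
proof -
  note q = cf_quotient_one_minus[OF assms]
  have "\<lfloor>1 / (1 - x)\<rfloor> = 1" using assms by (intro floor_unique) (auto simp: field_simps)
  then show "slope_exponent (1 - x) (Suc 0) = 0"
    using q(1) by (simp add: slope_exponent_def cf_coeff_def)
  show "slope_exponent (1 - x) (Suc (Suc k)) = slope_exponent x (Suc k)"
  proof (cases k)
    case 0
    then show ?thesis using q(2) by (simp add: slope_exponent_def cf_coeff_def numeral_2_eq_2)
  next
    case (Suc m)
    then show ?thesis using q(3)[of m]
      by (simp add: slope_exponent_def cf_coeff_def numeral_2_eq_2 numeral_3_eq_3 del: cf_quotient.simps)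
  qed
qed

lemma map_wpow: "map f (wpow w d) = wpow (map f w) d"
  by (simp add: wpow_def map_concat)

text \<open>The leading exponent 0 makes the words of 1 - x at indices 1 and 2 equal to 0 and 1, the
  complements of the two initial words of x. From there both sequences follow the same
  recursion.\<close>

lemma standard_seq_one_minus:
  assumes "0 < x" "x < 1 / 2"
  shows "standard_seq (1 - x) (Suc k) = map bit_complement (standard_seq x k)"
proof (induction k rule: induct_nat_012)
  case 1
  then show ?case
    using slope_exponent_one_minus(1)[OF assms] by (simp add: bit_complement_def wpow_def)
next
  case (ge2 n)
  then show ?case
    using slope_exponent_one_minus(2)[OF assms, of n]
    by (simp add: standard_seq.simps(3)[of _ "Suc n"] map_wpow del: standard_seq.simps(3))
       (simp add: map_wpow)
qed (simp add: bit_complement_def)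

text \<open>From some index on, the standard words of 1 - x are prefixes of the complemented word;
  uniqueness of the characteristic word then identifies it.\<close>

theorem word_complement_characteristic_word:
  assumes "x \<notin> \<rat>" "0 < x" "x < 1 / 2"
  shows "word_complement (characteristic_word x) = characteristic_word (1 - x)"
proof -
  have irr: "1 - x \<notin> \<rat>"
    using assms(1) Rats_diff[OF Rats_1, of "1 - x"] by auto
  obtain N where N: "\<forall>n\<ge>N. is_prefix_of (standard_seq x n) (characteristic_word x)"
    using characteristic_word_works[OF assms(1)] unfolding is_characteristic_word_def by blast
  have "is_prefix_of (standard_seq (1 - x) n) (word_complement (characteristic_word x))"
    if n: "n \<ge> Suc N" for n
  proof -
    obtain m where "n = Suc m" "m \<ge> N" using n by (metis Suc_le_D Suc_le_mono)
    moreover have "is_prefix_of (map bit_complement u) (word_complement w)" if "is_prefix_of u w" for u w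
      using that by (simp add: is_prefix_of_def word_complement_def)
    ultimately show ?thesis
      using N standard_seq_one_minus[OF assms(2,3), of m] by metis
  qed
  then have "is_characteristic_word (1 - x) (word_complement (characteristic_word x))"
    unfolding is_characteristic_word_def by blast
  then show ?thesis
    using characteristic_word_exists_unique[OF irr] characteristic_word_works[OF irr] by blast
qed

section \<open>The exchange relation, and induction over one period of exponents\<close>

section \<open>Worms\<close>

text \<open>The first identity is one use of the assumed relation, in the middle of its right-hand
  side. The second is the same relation one level up; three uses on the left and two on the right
  bring both sides to the same word.\<close>

lemma exchange_step:
  fixes S I :: bword
  assumes "wO @ S @ I = I @ S @ wE"
  defines "X \<equiv> S @ I @ S @ I @ S"
  shows "X @ wE @ S @ I @ S @ wO = S @ I @ S @ wO @ X @ wO"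
    and "wO @ (X @ wE @ (S @ I @ S) @ wO @ X) @ wO @ X @ wE
       = (wO @ X @ wE) @ (X @ wE @ (S @ I @ S) @ wO @ X) @ wE"
proof -
  \<comment> \<open>The arbitrary tail \<open>t\<close> lets the rule act inside a right-nested
    concatenation.\<close>
  have *: "wO @ S @ I @ t = I @ S @ wE @ t" for t
    using arg_cong[OF assms(1), of "\<lambda>w. w @ t"] by simp
  show "X @ wE @ S @ I @ S @ wO = S @ I @ S @ wO @ X @ wO"
    and "wO @ (X @ wE @ (S @ I @ S) @ wO @ X) @ wO @ X @ wE
       = (wO @ X @ wE) @ (X @ wE @ (S @ I @ S) @ wO @ X) @ wE"
    by (simp_all add: X_def *)
qed

lemma worm_exchange:
  assumes "wO @ S0 @ I0 = I0 @ S0 @ wE"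
  shows "wO @ worm_S S0 I0 k @ worm_I S0 I0 k = worm_I S0 I0 k @ worm_S S0 I0 k @ wE"
proof (induction k)
  case (Suc k)
  then show ?case using exchange_step(2)[OF Suc] by (simp add: Let_def)
qed (simp add: assms)

text \<open>Serves the one step of each period with exponent 2. With
  \<open>X = S @ I @ S @ I @ S\<close>, the recursion yields
  \<open>X @ wE @ X @ wE @ S @ I @ S @ wO\<close>; rewriting all that follows the first
  \<open>X @ wE\<close> turns this into the next S followed by \<open>wO\<close>.\<close>

lemma worm_exchange_X:
  fixes S0 I0 k
  defines "S \<equiv> worm_S S0 I0 k" and "I \<equiv> worm_I S0 I0 k"
  assumes "wO @ S0 @ I0 = I0 @ S0 @ wE"
  shows "S @ I @ S @ I @ S @ wE @ S @ I @ S @ wO = S @ I @ S @ wO @ S @ I @ S @ I @ S @ wO"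
  using exchange_step(1)[OF worm_exchange[OF assms(3), of k]] by (simp add: S_def I_def)

text \<open>The bound on \<open>l\<close> keeps \<open>n\<close> at least 2, away from the index
  where the exponent is the coefficient minus 1.\<close>

lemma standard_seq_cf_coeff:
  assumes "cf_coeff x n = int d" "n = Suc l" "m = Suc n" "l \<ge> 1"
  shows "standard_seq x m = wpow (standard_seq x n) d @ standard_seq x l"
  using assms by (cases l) (simp_all add: slope_exponent_def)

lemma wpow_1: "wpow w 1 = w"
  and wpow_2: "wpow w 2 = w @ w"
  by (simp_all add: wpow_def numeral_2_eq_2)

text \<open>The exponents at indices 4k+4 to 4k+7 are 1, 1, 1, 2. Two consecutive words determine
  the rest, so the induction carries only those at 4k+3 and 4k+4.\<close>

lemma articulated_worms:
  assumes cf: "cf_coeff x = ev_periodic [0, 3] [1, 2, 1, 1]"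
  defines "S \<equiv> worm_S [] [0]" and "I \<equiv> worm_I [] [0]" and "s \<equiv> standard_seq x"
  shows "s (4*k+3) = S k @ I k @ S k @ I k @ S k @ wE"
    and "s (4*k+4) = S (k+1) @ wO"
    and "s (4*k+5) = S (k+1) @ I (k+1)"
    and "s (4*k+6) = S (k+1) @ I (k+1) @ S (k+1) @ wO"
proof -
  have S_Suc: "S (Suc k) = S k @ I k @ S k @ I k @ S k @ wE @ S k @ I k @ S k @ wO
      @ S k @ I k @ S k @ I k @ S k"
    and I_Suc: "I (Suc k) = wO @ S k @ I k @ S k @ I k @ S k @ wE" for k
    by (simp_all add: S_def I_def Let_def)
  have ex: "wO @ S k @ I k = I k @ S k @ wE" for k
    unfolding S_def I_def by (rule worm_exchange) (simp add: wO_def wE_def)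
  have exX: "S k @ I k @ S k @ I k @ S k @ wE @ S k @ I k @ S k @ wO
      = S k @ I k @ S k @ wO @ S k @ I k @ S k @ I k @ S k @ wO" for k
    unfolding S_def I_def by (rule worm_exchange_X) (simp add: wO_def wE_def)
  have "s (4*k+5) = wpow (s (4*k+4)) 1 @ s (4*k+3)" "s (4*k+6) = wpow (s (4*k+5)) 1 @ s (4*k+4)"
    "s (4*k+7) = wpow (s (4*k+6)) 1 @ s (4*k+5)" "s (4*k+8) = wpow (s (4*k+7)) 2 @ s (4*k+6)" for k
    unfolding s_def by (rule standard_seq_cf_coeff; simp add: cf ev_periodic_def mod_Suc)+
  note rec = this[unfolded wpow_1 wpow_2 append_assoc]
  have *: "s (4*k+3) = S k @ I k @ S k @ I k @ S k @ wE \<and> s (4*k+4) = S (Suc k) @ wO" for k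
  proof (induction k)
    case 0
    \<comment> \<open>The first exponent is 3 - 1; the words up to index 4 are then computed
      outright.\<close>
    have "slope_exponent x 1 = 2" "slope_exponent x 2 = 1" "slope_exponent x 3 = 2"
      by (simp_all add: slope_exponent_def cf ev_periodic_def)
    then show ?case
      by (simp add: s_def S_def I_def eval_nat_numeral wpow_def Let_def wO_def wE_def)
  next
    case (Suc k)
    \<comment> \<open>The final \<open>wO\<close> of the word at 4k+4 and the whole word at 4k+3
      together form \<open>I (Suc k)\<close>.\<close>
    have s5: "s (4*k+5) = S (Suc k) @ I (Suc k)" using Suc by (simp add: rec I_Suc)
    have s6: "s (4*k+6) = S (Suc k) @ I (Suc k) @ S (Suc k) @ wO" using Suc s5 by (simp add: rec(2))
    \<comment> \<open>The recursion produces \<open>wO @ S (Suc k) @ I (Suc k)\<close> at the end,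
      which the exchange relation rewrites.\<close>
    have s7: "s (4*k+7) = S (Suc k) @ I (Suc k) @ S (Suc k) @ I (Suc k) @ S (Suc k) @ wE"
      using s5 s6 ex[of "Suc k"] by (simp add: rec(3))
    have "s (4*k+8) = S (Suc (Suc k)) @ wO"
      using s6 s7 exX[of "Suc k"] by (simp add: rec(4) S_Suc[of "Suc k"])
    then show ?case using s7 by (simp add: add.commute)
  qed
  show 3: "s (4*k+3) = S k @ I k @ S k @ I k @ S k @ wE"
    and 4: "s (4*k+4) = S (k+1) @ wO" using *[of k] by simp_all
  show 5: "s (4*k+5) = S (k+1) @ I (k+1)" by (simp add: rec(1) 3 4 I_Suc)
  show "s (4*k+6) = S (k+1) @ I (k+1) @ S (k+1) @ wO" by (simp add: rec(2) 4 5)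
qed

text \<open>The same cycle of four word shapes as for the articulated worms, entered two places
  later: the exponents at 4k+4 to 4k+7 are now 1, 2, 1, 1.\<close>

lemma wriggly_worms:
  assumes cf: "cf_coeff x = ev_periodic [0, 4] [1, 1, 1, 2]"
  defines "S \<equiv> worm_S [0, 0] [0, 1, 0]" and "I \<equiv> worm_I [0, 0] [0, 1, 0]" and "s \<equiv> standard_seq x"
  shows "s (4*k+3) = S k @ I k"
    and "s (4*k+4) = S k @ I k @ S k @ wO"
    and "s (4*k+5) = S k @ I k @ S k @ I k @ S k @ wE"
    and "s (4*k+6) = S (k+1) @ wO"
proof -
  have S_Suc: "S (Suc k) = S k @ I k @ S k @ I k @ S k @ wE @ S k @ I k @ S k @ wO
      @ S k @ I k @ S k @ I k @ S k"
    and I_Suc: "I (Suc k) = wO @ S k @ I k @ S k @ I k @ S k @ wE" for k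
    by (simp_all add: S_def I_def Let_def)
  have ex: "wO @ S k @ I k = I k @ S k @ wE" for k
    unfolding S_def I_def by (rule worm_exchange) (simp add: wO_def wE_def)
  have exX: "S k @ I k @ S k @ I k @ S k @ wE @ S k @ I k @ S k @ wO
      = S k @ I k @ S k @ wO @ S k @ I k @ S k @ I k @ S k @ wO" for k
    unfolding S_def I_def by (rule worm_exchange_X) (simp add: wO_def wE_def)
  have "s (4*k+5) = wpow (s (4*k+4)) 1 @ s (4*k+3)" "s (4*k+6) = wpow (s (4*k+5)) 2 @ s (4*k+4)"
    "s (4*k+7) = wpow (s (4*k+6)) 1 @ s (4*k+5)" "s (4*k+8) = wpow (s (4*k+7)) 1 @ s (4*k+6)" for k
    unfolding s_def by (rule standard_seq_cf_coeff; simp add: cf ev_periodic_def mod_Suc)+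
  note rec = this[unfolded wpow_1 wpow_2 append_assoc]
  \<comment> \<open>Stated for arbitrary \<open>k\<close> because it serves both the induction and
    the last two claims.\<close>
  have step: "s (4*k+5) = S k @ I k @ S k @ I k @ S k @ wE" "s (4*k+6) = S (Suc k) @ wO"
    if "s (4*k+3) = S k @ I k" "s (4*k+4) = S k @ I k @ S k @ wO" for k
  proof -
    show s5: "s (4*k+5) = S k @ I k @ S k @ I k @ S k @ wE"
      using that ex[of k] by (simp add: rec(1))
    show "s (4*k+6) = S (Suc k) @ wO"
      using s5 that exX[of k] by (simp add: rec(2) S_Suc)
  qed
  have *: "s (4*k+3) = S k @ I k \<and> s (4*k+4) = S k @ I k @ S k @ wO" for k
  proof (induction k)
    case 0
    have "slope_exponent x 1 = 3" "slope_exponent x 2 = 1" "slope_exponent x 3 = 1"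
      by (simp_all add: slope_exponent_def cf ev_periodic_def)
    then show ?case
      by (simp add: s_def S_def I_def eval_nat_numeral wpow_def Let_def wO_def wE_def)
  next
    case (Suc k)
    have s7: "s (4*k+7) = S (Suc k) @ I (Suc k)"
      using step[of k] Suc by (simp add: rec(3) I_Suc)
    have "s (4*k+8) = S (Suc k) @ I (Suc k) @ S (Suc k) @ wO"
      using step(2)[of k] Suc s7 by (simp add: rec(4))
    then show ?case using s7 by (simp add: add.commute)
  qed
  show "s (4*k+3) = S k @ I k" and "s (4*k+4) = S k @ I k @ S k @ wO"
    and "s (4*k+5) = S k @ I k @ S k @ I k @ S k @ wE" and "s (4*k+6) = S (k+1) @ wO"
    using *[of k] step[of k] by simp_all
qed

section \<open>Arithmetic with sqrt 6: irrationality, the two expansions and the quadratic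
  equations\<close>

section \<open>The two slopes\<close>

text \<open>The parity argument for sqrt 2 carries over because 6 is twice an odd number.\<close>

lemma sqrt_6_irrational: "sqrt 6 \<notin> \<rat>"
proof
  assume "sqrt 6 \<in> \<rat>"
  then obtain m n :: nat where n: "n \<noteq> 0" and mn: "\<bar>sqrt 6\<bar> = m / n" and cop: "coprime m n"
    by (rule Rats_abs_nat_div_natE)
  have "real m = sqrt 6 * n" using n mn by (simp add: field_simps)
  then have "real (m ^ 2) = real (6 * n ^ 2)" by (simp add: power_mult_distrib)
  then have eq: "m ^ 2 = 6 * n ^ 2" by (simp only: of_nat_eq_iff)
  then have "even (m ^ 2)" by simp
  then have "even m" by simp
  then obtain r where "m = 2 * r" by blast
  then have "2 * r ^ 2 = 3 * n ^ 2" using eq by (simp add: power_mult_distrib)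
  then have "even (3 * n ^ 2)" by (metis dvd_triv_left)
  then have "even n" by simp
  with \<open>even m\<close> cop show False by (metis coprime_common_divisor_nat nat_dvd_1_iff_1 one_eq_numeral_iff semiring_norm(83))
qed

lemma sqrt_6_bounds: "2.44 < sqrt 6" "sqrt 6 < 2.45"
  by (rule real_less_rsqrt real_less_lsqrt; simp add: power2_eq_square)+

lemma has_cf_a:
  assumes "a = 2 / 19 * (5 - sqrt 6)" "a \<notin> \<rat>"
  shows "has_cf a (ev_periodic [0, 3] [1, 2, 1, 1])"
proof -
  note b = sqrt_6_bounds
  have q1: "\<lfloor>a\<rfloor> = 0 \<and> 1 / frac a = (5 + sqrt 6) / 2"
    using b by (intro cf_step) (simp_all add: assms(1) field_simps)
  have q2: "\<lfloor>(5 + sqrt 6) / 2\<rfloor> = 3 \<and> 1 / frac ((5 + sqrt 6) / 2) = (2 * sqrt 6 + 2) / 5"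
    using b by (intro cf_step) (simp_all add: field_simps)
  have q3: "\<lfloor>(2 * sqrt 6 + 2) / 5\<rfloor> = 1 \<and> 1 / frac ((2 * sqrt 6 + 2) / 5) = (2 * sqrt 6 + 3) / 3"
    using b by (intro cf_step) (simp_all add: field_simps)
  have q4: "\<lfloor>(2 * sqrt 6 + 3) / 3\<rfloor> = 2 \<and> 1 / frac ((2 * sqrt 6 + 3) / 3) = (2 * sqrt 6 + 3) / 5"
    using b by (intro cf_step) (simp_all add: field_simps)
  have q5: "\<lfloor>(2 * sqrt 6 + 3) / 5\<rfloor> = 1 \<and> 1 / frac ((2 * sqrt 6 + 3) / 5) = (sqrt 6 + 1) / 2"
    using b by (intro cf_step) (simp_all add: field_simps)
  \<comment> \<open>The quotient at index 6 equals the one at index 2, which closes the period of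
    length 4.\<close>
  have q6: "\<lfloor>(sqrt 6 + 1) / 2\<rfloor> = 1 \<and> 1 / frac ((sqrt 6 + 1) / 2) = (2 * sqrt 6 + 2) / 5"
    using b by (intro cf_step) (simp_all add: field_simps)
  note q = q1 q2 q3 q4 q5 q6
  have "cf_coeff a = ev_periodic [0, 3] [1, 2, 1, 1]"
  proof (rule cf_coeff_eq_ev_periodic)
    show "cf_coeff a n = ([0, 3] @ [1, 2, 1, 1]) ! n"
      if "n < length [0, 3 :: int] + length [1, 2, 1, 1 :: int]" for n
      using that by (auto simp: less_Suc_eq cf_coeff_def q)
  qed (simp_all add: q)
  then show ?thesis using has_cf_cf_coeff[OF assms(2)] by simp
qed

text \<open>From index 2 on, \<open>b\<close> runs through the same four quotients as
  \<open>a\<close>, starting two places later in the cycle; hence its period is a rotation of that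
  of \<open>a\<close>.\<close>

lemma has_cf_b:
  assumes "b = 1 / 19 * (9 - 2 * sqrt 6)" "b \<notin> \<rat>"
  shows "has_cf b (ev_periodic [0, 4] [1, 1, 1, 2])"
proof -
  note b = sqrt_6_bounds
  have q1: "\<lfloor>b\<rfloor> = 0 \<and> 1 / frac b = (9 + 2 * sqrt 6) / 3"
    using b by (intro cf_step) (simp_all add: assms(1) field_simps)
  have q2: "\<lfloor>(9 + 2 * sqrt 6) / 3\<rfloor> = 4 \<and> 1 / frac ((9 + 2 * sqrt 6) / 3) = (2 * sqrt 6 + 3) / 5"
    using b by (intro cf_step) (simp_all add: field_simps)
  have q3: "\<lfloor>(2 * sqrt 6 + 3) / 5\<rfloor> = 1 \<and> 1 / frac ((2 * sqrt 6 + 3) / 5) = (sqrt 6 + 1) / 2"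
    using b by (intro cf_step) (simp_all add: field_simps)
  have q4: "\<lfloor>(sqrt 6 + 1) / 2\<rfloor> = 1 \<and> 1 / frac ((sqrt 6 + 1) / 2) = (2 * sqrt 6 + 2) / 5"
    using b by (intro cf_step) (simp_all add: field_simps)
  have q5: "\<lfloor>(2 * sqrt 6 + 2) / 5\<rfloor> = 1 \<and> 1 / frac ((2 * sqrt 6 + 2) / 5) = (2 * sqrt 6 + 3) / 3"
    using b by (intro cf_step) (simp_all add: field_simps)
  have q6: "\<lfloor>(2 * sqrt 6 + 3) / 3\<rfloor> = 2 \<and> 1 / frac ((2 * sqrt 6 + 3) / 3) = (2 * sqrt 6 + 3) / 5"
    using b by (intro cf_step) (simp_all add: field_simps)
  note q = q1 q2 q3 q4 q5 q6
  have "cf_coeff b = ev_periodic [0, 4] [1, 1, 1, 2]"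
  proof (rule cf_coeff_eq_ev_periodic)
    show "cf_coeff b n = ([0, 4] @ [1, 1, 1, 2]) ! n"
      if "n < length [0, 4 :: int] + length [1, 1, 1, 2 :: int]" for n
      using that by (auto simp: less_Suc_eq cf_coeff_def q)
  qed (simp_all add: q)
  then show ?thesis using has_cf_cf_coeff[OF assms(2)] by simp
qed

lemma quadratic_roots:
  fixes r s :: real
  assumes "\<And>x. p x = c * ((x - r) * (x - s))" "c \<noteq> 0"
  shows "{x. p x = 0} = {r, s}"
  using assms by auto

theorem mainTheorem3:
  fixes a b a' b' :: real
  assumes a_def: "a = 2 / 19 * (5 - sqrt 6)"
    and b_def: "b = 1 / 19 * (9 - 2 * sqrt 6)"
    and a'_def: "a' = 2 / 19 * (5 + sqrt 6)"
    and b'_def: "b' = 1 / 19 * (9 + 2 * sqrt 6)"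
  shows "(\<forall>x \<in> {a, b, a', b'}. 0 < x \<and> x < 1 \<and> x \<notin> \<rat>) \<and>
    has_cf a (ev_periodic [0, 3] [1, 2, 1, 1]) \<and>
    (\<forall>k.
      (let S = worm_S [] [0]; I = worm_I [] [0]; s = standard_seq a in
        s (4*k+3) = S k @ I k @ S k @ I k @ S k @ wE \<and>
        s (4*k+4) = S (k+1) @ wO \<and>
        s (4*k+5) = S (k+1) @ I (k+1) \<and>
        s (4*k+6) = S (k+1) @ I (k+1) @ S (k+1) @ wO)) \<and>
    has_cf b (ev_periodic [0, 4] [1, 1, 1, 2]) \<and>
    (\<forall>k.
      (let S = worm_S [0, 0] [0, 1, 0]; I = worm_I [0, 0] [0, 1, 0]; s = standard_seq b in
        s (4*k+3) = S k @ I k \<and>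
        s (4*k+4) = S k @ I k @ S k @ wO \<and>
        s (4*k+5) = S k @ I k @ S k @ I k @ S k @ wE \<and>
        s (4*k+6) = S (k+1) @ wO)) \<and>
    (a \<noteq> a' \<and> {x::real. 19*x^2 - 20*x + 4 = 0} = {a, a'}) \<and>
    (b \<noteq> b' \<and> {x::real. 19*x^2 - 18*x + 3 = 0} = {b, b'}) \<and>
    (\<forall>x::real. 19*(1-x)^2 - 20*(1-x) + 4 = 19*x^2 - 18*x + 3) \<and>
    word_complement (characteristic_word a) = characteristic_word b' \<and>
    word_complement (characteristic_word b) = characteristic_word a'"
proof (intro conjI)
  note defs = a_def b_def a'_def b'_def
  \<comment> \<open>Expressing sqrt 6 rationally through \<open>a\<close> or \<open>b\<close>
    transfers its irrationality to them.\<close>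
  have a: "sqrt 6 = 5 - 19 / 2 * a" and b: "sqrt 6 = (9 - 19 * b) / 2"
    and b': "b' = 1 - a" and a': "a' = 1 - b"
    by (simp_all add: defs field_simps)
  have irr_a: "a \<notin> \<rat>"
    using sqrt_6_irrational unfolding a
    by (metis Rats_diff Rats_divide Rats_mult Rats_number_of)
  have irr_b: "b \<notin> \<rat>"
    using sqrt_6_irrational unfolding b
    by (metis Rats_diff Rats_divide Rats_mult Rats_number_of)
  have irr_minus: "1 - x \<notin> \<rat>" if "x \<notin> \<rat>" for x :: real
    using that Rats_diff[OF Rats_1, of "1 - x"] by auto
  have bounds: "0 < a" "a < 1 / 2" "0 < b" "b < 1 / 2"
    using sqrt_6_bounds by (simp_all add: defs)
  show "\<forall>x \<in> {a, b, a', b'}. 0 < x \<and> x < 1 \<and> x \<notin> \<rat>"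
    using bounds irr_a irr_b irr_minus by (auto simp: a' b')
  show cf_a: "has_cf a (ev_periodic [0, 3] [1, 2, 1, 1])" using a_def irr_a by (rule has_cf_a)
  show cf_b: "has_cf b (ev_periodic [0, 4] [1, 1, 1, 2])" using b_def irr_b by (rule has_cf_b)
  show "\<forall>k. (let S = worm_S [] [0]; I = worm_I [] [0]; s = standard_seq a in
        s (4*k+3) = S k @ I k @ S k @ I k @ S k @ wE \<and>
        s (4*k+4) = S (k+1) @ wO \<and>
        s (4*k+5) = S (k+1) @ I (k+1) \<and>
        s (4*k+6) = S (k+1) @ I (k+1) @ S (k+1) @ wO)"
    using articulated_worms[of a] cf_a unfolding has_cf_def Let_def by blast
  show "\<forall>k. (let S = worm_S [0, 0] [0, 1, 0]; I = worm_I [0, 0] [0, 1, 0]; s = standard_seq b in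
        s (4*k+3) = S k @ I k \<and>
        s (4*k+4) = S k @ I k @ S k @ wO \<and>
        s (4*k+5) = S k @ I k @ S k @ I k @ S k @ wE \<and>
        s (4*k+6) = S (k+1) @ wO)"
    using wriggly_worms[of b] cf_b unfolding has_cf_def Let_def by blast
  show "a \<noteq> a'" "b \<noteq> b'" by (simp_all add: defs)
  show "{x::real. 19*x^2 - 20*x + 4 = 0} = {a, a'}"
    by (rule quadratic_roots[where c = 19])
       (simp_all add: a_def a'_def power2_eq_square field_simps)
  show "{x::real. 19*x^2 - 18*x + 3 = 0} = {b, b'}"
    by (rule quadratic_roots[where c = 19])
       (simp_all add: b_def b'_def power2_eq_square field_simps)
  show "\<forall>x::real. 19*(1-x)^2 - 20*(1-x) + 4 = 19*x^2 - 18*x + 3"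
    by (simp add: power2_eq_square algebra_simps)
  \<comment> \<open>Both \<open>a\<close> and \<open>b\<close> lie below 1/2, and reflection sends
    each to the conjugate of the other.\<close>
  show "word_complement (characteristic_word a) = characteristic_word b'"
    "word_complement (characteristic_word b) = characteristic_word a'"
    using word_complement_characteristic_word irr_a irr_b bounds by (simp_all add: a' b')
qed

end
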